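(* Let $\tilde{\mathbf{v}}\in\mathbb{R}^6$, $A_o>0$ and $s\in\{-1,1\}$. Let $\mathbf{v}\in\mathbb{R}^6$ be any optimal solution of the problem $\min_{\mathbf{v}\in\mathbb{R}^6}\|\mathbf{v}-\tilde{\mathbf{v}}\|^2$ subject to $sA^*(\mathbf{v})-A_o=0$, and let $\lambda\in\mathbb{R}$ be a Lagrange multiplier associated with it, i.e. such that $(\mathbf{v},\lambda)$ is a stationary pair. Then $|\lambda|\neq\lambda_o$ (Case I), except exactly when the setting $(\tilde{\mathbf{v}},A_o,s)$ is one of the following, in which case $|\lambda|=\lambda_o$ (Case II): \begin{itemize} \item $S_1$: $\tilde{\mathbf{v}}$ is a single point; \item $S_2$: $\tilde{\mathbf{v}}$ is an equilateral triangle and $s\,\mathrm{sign}(A^*(\tilde{\mathbf{v}}))=-1$; \item $S_3$: $\tilde{\mathbf{v}}$ is an equilateral triangle, $A(\tilde{\mathbf{v}})/4\geq A_o$ and $s\,\mathrm{sign}(A^*(\tilde{\mathbf{v}}))=1$. \end{itemize}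
   Context: A triangle with vertices $v_a=(x_a,y_a)$, $v_b=(x_b,y_b)$, $v_c=(x_c,y_c)$ in the plane is encoded as $\mathbf{v}=[x_a,y_a,x_b,y_b,x_c,y_c]^\top\in\mathbb{R}^6$. Its signed area is $A^*(\mathbf{v})=\frac{(x_a-x_c)(y_b-y_a)-(x_a-x_b)(y_c-y_a)}{2}$ and its area is $A(\mathbf{v})=|A^*(\mathbf{v})|$. The input triangle is $\tilde{\mathbf{v}}=[\tilde x_a,\tilde y_a,\tilde x_b,\tilde y_b,\tilde x_c,\tilde y_c]^\top$; $A_o>0$ is the prescribed area and $s\in\{-1,1\}$ the prescribed orientation. "$\tilde{\mathbf{v}}$ is a single point" means $\tilde v_a=\tilde v_b=\tilde v_c$; "$\tilde{\mathbf{v}}$ is an equilateral triangle" means that its three side lengths are equal and positive. The Lagrangian is $\mathscr{L}(\mathbf{v},\lambda)=\|\mathbf{v}-\tilde{\mathbf{v}}\|^2+\lambda\,(sA^*(\mathbf{v})-A_o)$ with $\lambda\in\mathbb{R}$. A pair $(\mathbf{v},\lambda)\in\mathbb{R}^6\times\mathbb{R}$ is a stationary pair if $\partial\mathscr{L}/\partial\mathbf{v}=0$ and $\partial\mathscr{L}/\partial\lambda=0$ at $(\mathbf{v},\lambda)$. The constant $\lambda_o$ is $\lambda_o=4/\sqrt{3}$. (The first condition is a linear system $X\mathbf{v}=\tilde{\mathbf{v}}$ with $\det X=(3\lambda^2-16)^2/256$, which is singular exactly when $|\lambda|=\lambda_o$.) Case I means $|\lambda|\neq\lambda_o$ and Case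 II means $|\lambda|=\lambda_o$. *)

theory Defs
  imports "HOL-Analysis.Analysis"
begin

text \<open>
  A triangle is the vector \<open>[x\<^sub>a, y\<^sub>a, x\<^sub>b, y\<^sub>b, x\<^sub>c, y\<^sub>c]\<close> of its vertex coordinates, components
  \<open>1\<close> to \<open>6\<close> in this order. The index type \<open>6\<close> is the integers modulo \<open>6\<close>, so its six elements
  are \<open>1, \<dots>, 6\<close> with \<open>6 = 0\<close>. Vertices live in \<open>real \<times> real\<close>, whose \<open>dist\<close> is Euclidean.
\<close>

type_synonym triangle = "real ^ 6"

definition vertex_a :: "triangle \<Rightarrow> real \<times> real" where
  "vertex_a v = (v $ 1, v $ 2)"

definition vertex_b :: "triangle \<Rightarrow> real \<times> real" where
  "vertex_b v = (v $ 3, v $ 4)"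

definition vertex_c :: "triangle \<Rightarrow> real \<times> real" where
  "vertex_c v = (v $ 5, v $ 6)"

text \<open>Positive when \<open>a, b, c\<close> are in counterclockwise order.\<close>

definition signed_area :: "triangle \<Rightarrow> real" where
  "signed_area v =
     (let (xa, ya) = vertex_a v; (xb, yb) = vertex_b v; (xc, yc) = vertex_c v
      in ((xa - xc) * (yb - ya) - (xa - xb) * (yc - ya)) / 2)"

definition area :: "triangle \<Rightarrow> real" where
  "area v = \<bar>signed_area v\<bar>"

definition single_point :: "triangle \<Rightarrow> bool" where
  "single_point v \<longleftrightarrow> vertex_a v = vertex_b v \<and> vertex_b v = vertex_c v"

definition equilateral :: "triangle \<Rightarrow> bool" where
  "equilateral v \<longleftrightarrow>
     dist (vertex_a v) (vertex_b v) = dist (vertex_b v) (vertex_c v) \<and>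
     dist (vertex_b v) (vertex_c v) = dist (vertex_c v) (vertex_a v) \<and>
     dist (vertex_a v) (vertex_b v) > 0"

definition optimal_solution :: "triangle \<Rightarrow> real \<Rightarrow> real \<Rightarrow> triangle \<Rightarrow> bool" where
  "optimal_solution vt Ao s v \<longleftrightarrow>
     is_arg_min (\<lambda>u. (norm (u - vt))\<^sup>2) (\<lambda>u. s * signed_area u - Ao = 0) v"

definition lagrangian :: "triangle \<Rightarrow> real \<Rightarrow> real \<Rightarrow> triangle \<Rightarrow> real \<Rightarrow> real" where
  "lagrangian vt Ao s v lam = (norm (v - vt))\<^sup>2 + lam * (s * signed_area v - Ao)"

definition stationary_pair :: "triangle \<Rightarrow> real \<Rightarrow> real \<Rightarrow> triangle \<Rightarrow> real \<Rightarrow> bool" where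
  "stationary_pair vt Ao s v lam \<longleftrightarrow>
     ((\<lambda>u. lagrangian vt Ao s u lam) has_derivative (\<lambda>h. 0)) (at v) \<and>
     ((\<lambda>l. lagrangian vt Ao s v l) has_real_derivative 0) (at lam)"

definition lambda_o :: real where
  "lambda_o = 4 / sqrt 3"

definition setting_S1 :: "triangle \<Rightarrow> bool" where
  "setting_S1 vt \<longleftrightarrow> single_point vt"

definition setting_S2 :: "triangle \<Rightarrow> real \<Rightarrow> bool" where
  "setting_S2 vt s \<longleftrightarrow> equilateral vt \<and> s * sgn (signed_area vt) = -1"

definition setting_S3 :: "triangle \<Rightarrow> real \<Rightarrow> real \<Rightarrow> bool" where
  "setting_S3 vt Ao s \<longleftrightarrow>
     equilateral vt \<and> area vt / 4 \<ge> Ao \<and> s * sgn (signed_area vt) = 1"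

end

theory Submission imports Defs begin

text \<open>
  Reading vertices as complex numbers, the discrete Fourier transform splits a triangle into its
  centroid and two equilateral components \<open>P\<close>, \<open>Q\<close> of orientation \<open>s\<close> and \<open>-s\<close>. This diagonalises
  both the norm and the area: \<open>s A\<^sup>*\<close> is a multiple of \<open>|P|\<^sup>2 - |Q|\<^sup>2\<close>. With \<open>\<mu> = \<lambda>/\<lambda>\<^sub>o\<close>, stationarity
  becomes \<open>P\<^sub>0 = (1 + \<mu>) P\<close> and \<open>Q\<^sub>0 = (1 - \<mu>) Q\<close>, where \<open>P\<^sub>0\<close>, \<open>Q\<^sub>0\<close> belong to the input triangle.
  As \<open>P \<noteq> 0\<close> by feasibility, \<open>\<mu> = -1\<close> iff \<open>P\<^sub>0 = 0\<close>, which is \<open>S\<^sub>1\<close> or \<open>S\<^sub>2\<close>. If \<open>\<mu> = 1\<close>, then \<open>Q\<^sub>0 = 0\<close> and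
  \<open>P = P\<^sub>0/2\<close>, and the area constraint gives \<open>S\<^sub>3\<close>. Conversely, under \<open>S\<^sub>3\<close> a solution with \<open>Q \<noteq> 0\<close> has
  \<open>\<mu> = 1\<close>, and one with \<open>Q = 0\<close> costs at least as much as a competitor with \<open>P = P\<^sub>0/2\<close>, with equality
  only if \<open>\<mu> = 1\<close>.
\<close>

lemma UNIV_6: "(UNIV :: 6 set) = {1, 2, 3, 4, 5, 6}"
proof -
  have "card {1, 2, 3, 4, 5, 6 :: 6} = CARD(6)"
    by simp
  then show ?thesis
    by (metis card_subset_eq finite subset_UNIV)
qed

lemma sum_6: "sum f (UNIV :: 6 set) = f 1 + f 2 + f 3 + f 4 + f 5 + f 6"
  unfolding UNIV_6 by (simp add: ac_simps)

text \<open>For \<open>s = \<plusminus>1\<close> this is \<open>z\<^sub>a + \<omega>\<^sup>-\<^sup>s z\<^sub>b + \<omega>\<^sup>s z\<^sub>c\<close> with \<open>\<omega> = exp (2\<pi>i/3)\<close>.\<close>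

definition equilateral_part :: "real \<Rightarrow> triangle \<Rightarrow> complex" where
  "equilateral_part s v =
     Complex (v $ 1 - (v $ 3 + v $ 5) / 2 + s * sqrt 3 / 2 * (v $ 4 - v $ 6))
             (v $ 2 - (v $ 4 + v $ 6) / 2 - s * sqrt 3 / 2 * (v $ 3 - v $ 5))"

definition vertex_sum :: "triangle \<Rightarrow> complex" where
  "vertex_sum v = Complex (v $ 1 + v $ 3 + v $ 5) (v $ 2 + v $ 4 + v $ 6)"

lemma linear_equilateral_part: "linear (equilateral_part s)"
  by (rule linearI) (simp_all add: equilateral_part_def complex_eq_iff field_simps)

lemma linear_vertex_sum: "linear vertex_sum"
  by (rule linearI) (simp_all add: vertex_sum_def complex_eq_iff field_simps)

lemma orientation_sqrt3:
  fixes s :: real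
  assumes "s \<in> {-1, 1}"
  shows "(s * sqrt 3) * (s * sqrt 3) = 3"
  using assms by auto

text \<open>Parseval's identity for the Fourier transform of length three.\<close>

lemma norm_triangle_decomp:
  assumes "s \<in> {-1, 1}"
  shows "(norm v)\<^sup>2 = ((norm (vertex_sum v))\<^sup>2 + (norm (equilateral_part s v))\<^sup>2
           + (norm (equilateral_part (- s) v))\<^sup>2) / 3"
proof -
  \<comment> \<open>With \<open>t\<close> atomic and \<open>t * t = 3\<close>, the claim is a
    polynomial identity; the second rule in \<open>t\<close> reduces nested products.\<close>
  define t where "t = s * sqrt 3"
  have t: "t * t = 3" "t * (t * x) = 3 * x" for x
    using orientation_sqrt3[OF assms] by (simp_all add: t_def flip: mult.assoc)
  have s: "s * sqrt 3 = t" "- s * sqrt 3 = - t" by (simp_all add: t_def)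
  show ?thesis
    unfolding power2_norm_eq_inner inner_vec_def sum_6 equilateral_part_def vertex_sum_def
      inner_complex_def s complex.sel inner_real_def
    by (simp add: field_simps t)
qed

lemma signed_area_decomp:
  assumes "s \<in> {-1, 1}"
  shows "s * signed_area v = sqrt 3 / 12 *
           ((norm (equilateral_part s v))\<^sup>2 - (norm (equilateral_part (- s) v))\<^sup>2)"
proof -
  define t where "t = s * sqrt 3"
  have t: "t * t = 3" "t * (t * x) = 3 * x" for x
    using orientation_sqrt3[OF assms] by (simp_all add: t_def flip: mult.assoc)
  have s: "s * sqrt 3 = t" "- s * sqrt 3 = - t" by (simp_all add: t_def)
  have "signed_area v =
      t / 12 * ((norm (equilateral_part s v))\<^sup>2 - (norm (equilateral_part (- s) v))\<^sup>2)"
    unfolding power2_norm_eq_inner signed_area_def vertex_a_def vertex_b_def vertex_c_def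
      equilateral_part_def Let_def prod.case inner_complex_def s complex.sel inner_real_def
    by (simp add: field_simps t)
  then show ?thesis using assms by (auto simp: t_def)
qed

text \<open>Inverse Fourier transform: the three parts can be prescribed independently. This
  supplies the test direction for stationarity and the competitor for optimality.\<close>

lemma triangle_with_parts:
  assumes "s \<in> {-1, 1}"
  obtains v where "vertex_sum v = g" "equilateral_part s v = p" "equilateral_part (- s) v = q"
proof
  define r where "r = s * sqrt 3 / 2"
  have r: "r * r = 3 / 4" "r * (r * x) = 3 / 4 * x" for x
    using orientation_sqrt3[OF assms] by (simp_all add: r_def field_simps flip: mult.assoc)
  define v :: triangle where "v = (\<chi> i.
    if i = 1 then (Re g + Re p + Re q) / 3
    else if i = 2 then (Im g + Im p + Im q) / 3
    else if i = 3 then (Re g - (Re p + Re q) / 2 - r * (Im p - Im q)) / 3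
    else if i = 4 then (Im g - (Im p + Im q) / 2 + r * (Re p - Re q)) / 3
    else if i = 5 then (Re g - (Re p + Re q) / 2 + r * (Im p - Im q)) / 3
    else (Im g - (Im p + Im q) / 2 - r * (Re p - Re q)) / 3)"
  have v: "v $ 1 = (Re g + Re p + Re q) / 3" "v $ 2 = (Im g + Im p + Im q) / 3"
    "v $ 3 = (Re g - (Re p + Re q) / 2 - r * (Im p - Im q)) / 3"
    "v $ 4 = (Im g - (Im p + Im q) / 2 + r * (Re p - Re q)) / 3"
    "v $ 5 = (Re g - (Re p + Re q) / 2 + r * (Im p - Im q)) / 3"
    "v $ 6 = (Im g - (Im p + Im q) / 2 - r * (Re p - Re q)) / 3"
    by (simp_all add: v_def)
  have s: "s * sqrt 3 / 2 = r" "- s * sqrt 3 / 2 = - r" by (simp_all add: r_def)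
  show "vertex_sum v = g"
    unfolding vertex_sum_def v complex_eq_iff complex.sel by (simp add: field_simps)
  show "equilateral_part s v = p"
    unfolding equilateral_part_def v complex_eq_iff complex.sel s by (simp add: field_simps r)
  show "equilateral_part (- s) v = q"
    unfolding equilateral_part_def v complex_eq_iff complex.sel s by (simp add: field_simps r)
qed

lemma single_point_iff:
  assumes "s \<in> {-1, 1}"
  shows "single_point v \<longleftrightarrow> equilateral_part s v = 0 \<and> equilateral_part (- s) v = 0"
proof
  assume "single_point v"
  then show "equilateral_part s v = 0 \<and> equilateral_part (- s) v = 0"
    by (simp add: single_point_def vertex_a_def vertex_b_def vertex_c_def equilateral_part_def
        complex_eq_iff)
next
  define r where "r = s * sqrt 3 / 2"
  have r: "r \<noteq> 0" using assms by (auto simp: r_def)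
  have s: "s * sqrt 3 / 2 = r" "- s * sqrt 3 / 2 = - r" by (simp_all add: r_def)
  assume "equilateral_part s v = 0 \<and> equilateral_part (- s) v = 0"
  then have *: "v $ 1 - (v $ 3 + v $ 5) / 2 + r * (v $ 4 - v $ 6) = 0"
    "v $ 1 - (v $ 3 + v $ 5) / 2 + - r * (v $ 4 - v $ 6) = 0"
    "v $ 2 - (v $ 4 + v $ 6) / 2 - r * (v $ 3 - v $ 5) = 0"
    "v $ 2 - (v $ 4 + v $ 6) / 2 - - r * (v $ 3 - v $ 5) = 0"
    unfolding equilateral_part_def complex_eq_iff complex.sel zero_complex.sel s by blast+
  then have "r * (v $ 4 - v $ 6) = 0" "r * (v $ 3 - v $ 5) = 0" by linarith+
  with r have "v $ 4 = v $ 6" "v $ 3 = v $ 5" by simp_all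
  with * show "single_point v"
    by (simp add: single_point_def vertex_a_def vertex_b_def vertex_c_def)
qed

text \<open>The squared norms of the two parts add up to the sum of the squared sides, and their
  difference is a multiple of the area. Equal sides and negative orientation make the difference
  minus the sum, which kills the part for \<open>s\<close>.\<close>

lemma equilateral_opposite_iff:
  assumes s: "s \<in> {-1, 1}"
  shows "equilateral v \<and> s * sgn (signed_area v) = -1 \<longleftrightarrow>
           equilateral_part s v = 0 \<and> equilateral_part (- s) v \<noteq> 0"
proof -
  define r where "r = sqrt 3"
  have r: "r * r = 3" "r > 0" by (simp_all add: r_def)
  define t where "t = s * r"
  have t: "t * t = 3" "t * (t * x) = 3 * x" for x
    using orientation_sqrt3[OF s] by (simp_all add: t_def r_def flip: mult.assoc)
  have st: "s * sqrt 3 = t" "- s * sqrt 3 = - t" by (simp_all add: t_def r_def)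
  let ?P = "equilateral_part s v" and ?Q = "equilateral_part (- s) v" and ?A = "signed_area v"
  define l where "l i j k m = (v $ i - v $ k)\<^sup>2 + (v $ j - v $ m)\<^sup>2" for i j k m
  have dists: "dist (vertex_a v) (vertex_b v) = sqrt (l 1 2 3 4)"
    "dist (vertex_b v) (vertex_c v) = sqrt (l 3 4 5 6)"
    "dist (vertex_c v) (vertex_a v) = sqrt (l 5 6 1 2)"
    by (simp_all add: vertex_a_def vertex_b_def vertex_c_def dist_Pair_Pair dist_real_def l_def)
  have eq: "equilateral v \<longleftrightarrow> l 1 2 3 4 = l 3 4 5 6 \<and> l 3 4 5 6 = l 5 6 1 2 \<and> l 1 2 3 4 > 0"
    unfolding equilateral_def dists by simp
  have sgn: "s * sgn ?A = -1 \<longleftrightarrow> s * ?A < 0"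
    using s by (auto simp: sgn_if)
  have area: "s * ?A = r / 12 * ((norm ?P)\<^sup>2 - (norm ?Q)\<^sup>2)"
    using signed_area_decomp[OF s] by (simp add: r_def)
  have sum: "(norm ?P)\<^sup>2 + (norm ?Q)\<^sup>2 = l 1 2 3 4 + l 3 4 5 6 + l 5 6 1 2"
    unfolding power2_norm_eq_inner l_def equilateral_part_def inner_complex_def st complex.sel
      inner_real_def
    by (simp add: field_simps t power2_eq_square)
  show ?thesis
    unfolding eq sgn
  proof safe
    assume l: "l 1 2 3 4 = l 3 4 5 6" "l 3 4 5 6 = l 5 6 1 2" "l 1 2 3 4 > 0" and neg: "s * ?A < 0"
    \<comment> \<open>Heron's formula\<close>
    have "16 * ?A\<^sup>2 = 2 * (l 1 2 3 4 * l 3 4 5 6 + l 3 4 5 6 * l 5 6 1 2 + l 5 6 1 2 * l 1 2 3 4)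
        - ((l 1 2 3 4)\<^sup>2 + (l 3 4 5 6)\<^sup>2 + (l 5 6 1 2)\<^sup>2)"
      unfolding l_def signed_area_def vertex_a_def vertex_b_def vertex_c_def Let_def prod.case
      by (simp add: power2_eq_square field_simps)
    then have "(4 * (s * ?A))\<^sup>2 = (r * l 1 2 3 4)\<^sup>2"
      using l(1,2) r(1) s by (auto simp: power2_eq_square)
    moreover have "r * l 1 2 3 4 > 0" using l(3) r(2) by simp
    ultimately have "4 * (s * ?A) = - (r * l 1 2 3 4)"
      using neg by (smt (verit) power2_eq_iff)
    then have "r * ((norm ?P)\<^sup>2 - (norm ?Q)\<^sup>2) = r * (- 3 * l 1 2 3 4)"
      unfolding area by (simp add: field_simps)
    then have diff: "(norm ?P)\<^sup>2 - (norm ?Q)\<^sup>2 = - 3 * l 1 2 3 4"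
      using r(2) by (metis less_irrefl mult_left_cancel)
    with sum l have "(norm ?P)\<^sup>2 = 0" by linarith
    then show "?P = 0" by simp
    assume "?Q = 0"
    with diff sum l show False by simp
  next
    assume P: "?P = 0" and Q: "?Q \<noteq> 0"
    \<comment> \<open>Solved for the first vertex, \<open>?P = 0\<close> puts it at the apex of an
      equilateral triangle over the side from b to c.\<close>
    from P have "v $ 1 - (v $ 3 + v $ 5) / 2 + t / 2 * (v $ 4 - v $ 6) = 0"
      "v $ 2 - (v $ 4 + v $ 6) / 2 - t / 2 * (v $ 3 - v $ 5) = 0"
      unfolding equilateral_part_def complex_eq_iff complex.sel zero_complex.sel st by blast+
    then have v: "v $ 1 = (v $ 3 + v $ 5) / 2 - t / 2 * (v $ 4 - v $ 6)"
      "v $ 2 = (v $ 4 + v $ 6) / 2 + t / 2 * (v $ 3 - v $ 5)"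
      by linarith+
    show 1: "l 1 2 3 4 = l 3 4 5 6" and 2: "l 3 4 5 6 = l 5 6 1 2"
      unfolding l_def v by (simp_all add: field_simps t power2_eq_square)
    have pos: "(norm ?Q)\<^sup>2 > 0" using Q by simp
    then show "l 1 2 3 4 > 0" using sum 1 2 unfolding P norm_zero power_zero_numeral by linarith
    show "s * ?A < 0" using pos r(2) unfolding area P by (simp add: mult_less_0_iff)
  qed
qed

text \<open>In Fourier coordinates the Lagrangian is a sum of separate quadratics, so its gradient
  splits into one equation per part.\<close>

lemma stationary_parts:
  assumes s: "s \<in> {-1, 1}" and stat: "stationary_pair vt Ao s v lam"
  defines "\<mu> \<equiv> sqrt 3 / 4 * lam"
  shows "equilateral_part s vt = (1 + \<mu>) *\<^sub>R equilateral_part s v"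
    and "equilateral_part (- s) vt = (1 - \<mu>) *\<^sub>R equilateral_part (- s) v"
    and "vertex_sum v = vertex_sum vt"
    and "s * signed_area v = Ao"
proof -
  let ?G = vertex_sum and ?P = "equilateral_part s" and ?Q = "equilateral_part (- s)"
  have "bounded_linear ?G" "bounded_linear ?P" "bounded_linear ?Q"
    by (simp_all add: linear_linear linear_equilateral_part linear_vertex_sum)
  note deriv = this[THEN bounded_linear.has_derivative]
  have diff: "?G (u - vt) = ?G u - ?G vt" "?P (u - vt) = ?P u - ?P vt" "?Q (u - vt) = ?Q u - ?Q vt" for u
    by (simp_all add: linear_diff linear_equilateral_part linear_vertex_sum)
  have L: "lagrangian vt Ao s u lam =
      ((?G u - ?G vt) \<bullet> (?G u - ?G vt) + (?P u - ?P vt) \<bullet> (?P u - ?P vt)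
        + (?Q u - ?Q vt) \<bullet> (?Q u - ?Q vt)) / 3
      + lam * (sqrt 3 / 12 * (?P u \<bullet> ?P u - ?Q u \<bullet> ?Q u) - Ao)" for u
    unfolding lagrangian_def norm_triangle_decomp[OF s] signed_area_decomp[OF s] diff
    by (simp add: power2_norm_eq_inner)
  have "((\<lambda>u. lagrangian vt Ao s u lam) has_derivative
     (\<lambda>h. 2 / 3 * (?G h \<bullet> (?G v - ?G vt) + ?P h \<bullet> (?P v - ?P vt + \<mu> *\<^sub>R ?P v)
        + ?Q h \<bullet> (?Q v - ?Q vt - \<mu> *\<^sub>R ?Q v)))) (at v)"
    unfolding L
    by (auto intro!: derivative_eq_intros deriv
        simp: fun_eq_iff \<mu>_def inner_commute inner_simps field_simps)
  moreover have "((\<lambda>u. lagrangian vt Ao s u lam) has_derivative (\<lambda>h. 0)) (at v)"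
    using stat by (simp add: stationary_pair_def)
  ultimately have zero: "?G h \<bullet> (?G v - ?G vt) + ?P h \<bullet> (?P v - ?P vt + \<mu> *\<^sub>R ?P v)
        + ?Q h \<bullet> (?Q v - ?Q vt - \<mu> *\<^sub>R ?Q v) = 0" for h
    using has_derivative_unique by (fastforce dest: fun_cong[where x = h])
  \<comment> \<open>Testing with the gradient's own components turns \<open>zero\<close> into a
    vanishing sum of three squared norms.\<close>
  obtain h where h: "?G h = ?G v - ?G vt" "?P h = ?P v - ?P vt + \<mu> *\<^sub>R ?P v"
    "?Q h = ?Q v - ?Q vt - \<mu> *\<^sub>R ?Q v"
    using triangle_with_parts[OF s] by metis
  have "?G h = 0" "?P h = 0" "?Q h = 0"
    using zero[of h] unfolding h[symmetric]
    by (smt (verit) inner_ge_zero inner_eq_zero_iff)+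
  then show "?P vt = (1 + \<mu>) *\<^sub>R ?P v" "?Q vt = (1 - \<mu>) *\<^sub>R ?Q v" "?G v = ?G vt"
    unfolding h by (simp_all add: algebra_simps)
  have "((\<lambda>l. lagrangian vt Ao s v l) has_real_derivative (s * signed_area v - Ao)) (at lam)"
    unfolding lagrangian_def by (auto intro!: derivative_eq_intros)
  with stat show "s * signed_area v = Ao"
    unfolding stationary_pair_def using DERIV_unique by fastforce
qed

theorem proposition1:
  fixes vt v :: triangle and Ao s lam :: real
  assumes "Ao > 0"
    and "s \<in> {-1, 1}"
    and "optimal_solution vt Ao s v"
    and "stationary_pair vt Ao s v lam"
  shows "(\<not> (setting_S1 vt \<or> setting_S2 vt s \<or> setting_S3 vt Ao s) \<longrightarrow> \<bar>lam\<bar> \<noteq> lambda_o) \<and>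
         ((setting_S1 vt \<or> setting_S2 vt s \<or> setting_S3 vt Ao s) \<longrightarrow> \<bar>lam\<bar> = lambda_o)"
proof -
  note s = assms(2)
  then have s': "- s \<in> {-1, 1}" by auto
  let ?G = vertex_sum and ?P = "equilateral_part s" and ?Q = "equilateral_part (- s)"
  define \<mu> where "\<mu> = sqrt 3 / 4 * lam"
  \<comment> \<open>Scaled so that the area constraint reads |P|^2 = k + |Q|^2.\<close>
  define k where "k = 4 * sqrt 3 * Ao"
  have k: "k > 0" using assms(1) by (simp add: k_def)
  have Ao: "Ao = sqrt 3 / 12 * k" by (simp add: k_def)
  have stat: "?P vt = (1 + \<mu>) *\<^sub>R ?P v" "?Q vt = (1 - \<mu>) *\<^sub>R ?Q v" "?G v = ?G vt"
    "s * signed_area v = Ao"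
    using stationary_parts[OF s assms(4)] by (simp_all add: \<mu>_def)
  have feasible: "s * signed_area u - Ao = 0 \<longleftrightarrow> (norm (?P u))\<^sup>2 = k + (norm (?Q u))\<^sup>2" for u
    unfolding signed_area_decomp[OF s] Ao by (auto simp flip: right_diff_distrib)
  have constr: "(norm (?P v))\<^sup>2 = k + (norm (?Q v))\<^sup>2"
    using stat(4) feasible[of v] by simp
  then have "(norm (?P v))\<^sup>2 > 0" using k by (simp add: add_pos_nonneg)
  then have P: "?P v \<noteq> 0" by auto
  have "\<bar>lam\<bar> = lambda_o \<longleftrightarrow> \<bar>\<mu>\<bar> = 1"
    by (simp add: \<mu>_def lambda_o_def abs_mult field_simps)
  then have lam: "\<bar>lam\<bar> = lambda_o \<longleftrightarrow> \<mu> = -1 \<or> \<mu> = 1" by linarith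
  \<comment> \<open>Both settings say \<open>?P vt = 0\<close>; whether \<open>?Q vt\<close>
    vanishes tells them apart.\<close>
  have S12: "setting_S1 vt \<or> setting_S2 vt s \<longleftrightarrow> \<mu> = -1"
    using P unfolding setting_S1_def setting_S2_def single_point_iff[OF s]
      equilateral_opposite_iff[OF s] stat(1) by auto
  \<comment> \<open>Flipping \<open>s\<close> swaps the two parts, so the criterion for opposite
    orientation applies again.\<close>
  have "setting_S3 vt Ao s \<longleftrightarrow> equilateral vt \<and> - s * sgn (signed_area vt) = -1 \<and> area vt / 4 \<ge> Ao"
    unfolding setting_S3_def by auto
  also have "\<dots> \<longleftrightarrow> ?Q vt = 0 \<and> ?P vt \<noteq> 0 \<and> area vt / 4 \<ge> Ao"
    using equilateral_opposite_iff[OF s', of vt] by auto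
  also have "\<dots> \<longleftrightarrow> ?Q vt = 0 \<and> ?P vt \<noteq> 0 \<and> (norm (?P vt))\<^sup>2 \<ge> 4 * k"
  proof -
    have "area vt = \<bar>s * signed_area vt\<bar>" using s by (auto simp: area_def)
    then have "area vt / 4 = sqrt 3 / 12 * ((norm (?P vt))\<^sup>2 / 4)" if "?Q vt = 0"
      using that by (simp add: signed_area_decomp[OF s])
    moreover have "Ao \<le> sqrt 3 / 12 * (x / 4) \<longleftrightarrow> 4 * k \<le> x" for x
      unfolding Ao by (subst mult_le_cancel_left_pos) auto
    ultimately show ?thesis by metis
  qed
  finally have S3: "setting_S3 vt Ao s \<longleftrightarrow> ?Q vt = 0 \<and> ?P vt \<noteq> 0 \<and> (norm (?P vt))\<^sup>2 \<ge> 4 * k" .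
  \<comment> \<open>Here \<open>?P vt\<close> is twice \<open>?P v\<close>, so its squared norm is 4
    (k + |Q|^2) \<ge> 4 k.\<close>
  have "setting_S3 vt Ao s" if "\<mu> = 1"
    using P constr unfolding S3 stat(1,2) that by (simp add: power_mult_distrib)
  moreover have "\<mu> = 1" if "setting_S3 vt Ao s"
  proof (cases "?Q v = 0")
    case False
    then show ?thesis using that unfolding S3 stat(2) by simp
  next
    case True
    have S: "?Q vt = 0" "(norm (?P vt))\<^sup>2 \<ge> 4 * k" using that by (auto simp: S3)
    \<comment> \<open>The competitor \<open>u\<close> halves \<open>?P vt\<close>, as stationarity
      with \<mu> = 1 demands; \<open>t\<close> is the size of its other part that restores
      feasibility, real by the area bound of the third setting.\<close>
    define t where "t = sqrt ((norm (?P vt))\<^sup>2 / 4 - k)"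
    have t: "t\<^sup>2 = (norm (?P vt))\<^sup>2 / 4 - k" using S(2) by (simp add: t_def)
    obtain u where u: "?G u = ?G vt" "?P u = (1 / 2) *\<^sub>R ?P vt" "?Q u = of_real t"
      using triangle_with_parts[OF s] by metis
    have cost: "3 * (norm (w - vt))\<^sup>2 =
        (norm (?G w - ?G vt))\<^sup>2 + (norm (?P w - ?P vt))\<^sup>2 + (norm (?Q w - ?Q vt))\<^sup>2" for w
      by (simp add: norm_triangle_decomp[OF s, of "w - vt"] linear_diff linear_equilateral_part
          linear_vertex_sum)
    have "(norm (?P u))\<^sup>2 = k + (norm (?Q u))\<^sup>2"
      unfolding u by (simp add: t power_mult_distrib power_divide)
    then have "(norm (v - vt))\<^sup>2 \<le> (norm (u - vt))\<^sup>2"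
      using assms(3) unfolding optimal_solution_def is_arg_min_linorder feasible by auto
    then have "3 * (norm (v - vt))\<^sup>2 \<le> 3 * (norm (u - vt))\<^sup>2" by simp
    moreover have "?P v - ?P vt = (- \<mu>) *\<^sub>R ?P v" "?P u - ?P vt = (- 1 / 2) *\<^sub>R ?P vt"
      unfolding stat(1) u(2) by (simp_all add: scaleR_conv_of_real algebra_simps)
    then have "(norm (?P v - ?P vt))\<^sup>2 = \<mu>\<^sup>2 * (norm (?P v))\<^sup>2"
      "(norm (?P u - ?P vt))\<^sup>2 = (norm (?P vt))\<^sup>2 / 4"
      by (simp_all add: power_mult_distrib power_divide)
    \<comment> \<open>Since \<open>?Q v = 0\<close>, |P|^2 = k and the left side is three times the
      cost of \<open>v\<close>; the competitor's is |P0|^2 / 4 + \<open>t\<close>^2, where P0 is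
      \<open>?P vt\<close>. Substituting P0 = (1 + \<mu>) P leaves a square that must
      vanish.\<close>
    ultimately have "\<mu>\<^sup>2 * k \<le> (norm (?P vt))\<^sup>2 / 2 - k"
      unfolding cost using True S(1) u(1,3) t constr stat(3) by simp
    also have "(norm (?P vt))\<^sup>2 = (1 + \<mu>)\<^sup>2 * k"
      using True constr unfolding stat(1) by (simp add: power_mult_distrib)
    finally have "k * (\<mu> - 1)\<^sup>2 \<le> 0"
      by (simp add: power2_eq_square field_simps)
    then show ?thesis using k by (simp add: mult_le_0_iff)
  qed
  ultimately show ?thesis using lam S12 by blast
qed

end
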